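(* For every integer $d\ge 1$, $s\chi(d)\ge 2d$.
   Context: A graph $G=(V,E)$ is strongly $k$-colorable if for every collection $V_1,\dots,V_r$ of pairwise disjoint subsets of $V$, each of size at most $k$, the graph obtained from $G$ by adding all edges between distinct vertices within each $V_i$ is properly $k$-colorable. The strong chromatic number $s\chi(G)$ is the minimum $k$ such that $G$ is strongly $k$-colorable, and $s\chi(d)=\max s\chi(G)$ over all finite simple graphs $G$ of maximum degree at most $d$. *)

theory Defs
  imports "Graph_Theory.Pair_Digraph" "HOL-Library.Extended_Nat" "HOL-Library.Disjoint_Sets"
begin

text \<open>
  A finite simple graph is a \<open>pair_graph\<close>: an undirected edge \<open>uv\<close> is represented by the two
  arcs \<open>(u, v)\<close> and \<open>(v, u)\<close>, so the degree of a vertex is its \<open>out_degree\<close>.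
\<close>

definition proper_coloring :: "'a pair_pre_digraph \<Rightarrow> nat \<Rightarrow> ('a \<Rightarrow> nat) \<Rightarrow> bool" where
  "proper_coloring G k c \<longleftrightarrow>
     (\<forall>v \<in> pverts G. c v < k) \<and> (\<forall>(u, v) \<in> parcs G. c u \<noteq> c v)"

definition colorable :: "'a pair_pre_digraph \<Rightarrow> nat \<Rightarrow> bool" where
  "colorable G k \<longleftrightarrow> (\<exists>c. proper_coloring G k c)"

definition add_cliques :: "'a pair_pre_digraph \<Rightarrow> nat \<Rightarrow> (nat \<Rightarrow> 'a set) \<Rightarrow> 'a pair_pre_digraph" where
  "add_cliques G r W =
     \<lparr> pverts = pverts G,
       parcs = parcs G \<union> (\<Union>i<r. {(u, v). u \<in> W i \<and> v \<in> W i \<and> u \<noteq> v}) \<rparr>"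

definition strongly_colorable :: "'a pair_pre_digraph \<Rightarrow> nat \<Rightarrow> bool" where
  "strongly_colorable G k \<longleftrightarrow>
     (\<forall>r W. disjoint_family_on W {..<r} \<and>
            (\<forall>i<r. W i \<subseteq> pverts G \<and> finite (W i) \<and> card (W i) \<le> k) \<longrightarrow>
            colorable (add_cliques G r W) k)"

definition strong_chromatic_number :: "'a pair_pre_digraph \<Rightarrow> nat" where
  "strong_chromatic_number G = (LEAST k. strongly_colorable G k)"

text \<open>
  The maximum of the strong chromatic number over the finite simple graphs of maximum degree at
  most \<open>d\<close>. Every finite graph has an isomorphic copy with vertices in \<open>nat\<close>. The supremum is
  taken in \<open>enat\<close>, where it is the maximum whenever the values are bounded, and \<open>\<infinity>\<close> otherwise.
\<close>

definition max_strong_chromatic_number :: "nat \<Rightarrow> enat" where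
  "max_strong_chromatic_number d =
     (SUP G \<in> {G :: nat pair_pre_digraph. pair_graph G \<and>
                 (\<forall>v \<in> pverts G. out_degree (with_proj G) v \<le> d)}.
        enat (strong_chromatic_number G))"

text \<open>For finite simple graphs the minimum defining \<open>strong_chromatic_number\<close> exists.\<close>

lemma strongly_colorable_card:
  fixes G :: "'a pair_pre_digraph"
  assumes "pair_graph G"
  shows "strongly_colorable G (card (pverts G))"
proof -
  interpret pair_graph G by fact
  obtain c where c: "bij_betw c (pverts G) {0..<card (pverts G)}"
    using ex_bij_betw_finite_nat[OF pair_finite_verts] by blast
  have lt: "c v < card (pverts G)" if "v \<in> pverts G" for v
    using c that by (auto simp: bij_betw_def)
  have neq: "c u \<noteq> c v" if "u \<in> pverts G" "v \<in> pverts G" "u \<noteq> v" for u v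
    using c that by (auto simp: bij_betw_def inj_on_def)
  have arc: "u \<in> pverts G \<and> v \<in> pverts G \<and> u \<noteq> v" if "(u, v) \<in> parcs G" for u v
    using that in_arcsD1 in_arcsD2 pair_no_loops by fastforce
  show ?thesis
    unfolding strongly_colorable_def colorable_def
  proof (intro allI impI)
    fix r :: nat and W :: "nat \<Rightarrow> 'a set"
    assume W: "disjoint_family_on W {..<r} \<and>
      (\<forall>i<r. W i \<subseteq> pverts G \<and> finite (W i) \<and> card (W i) \<le> card (pverts G))"
    have "c u \<noteq> c v" if uv: "(u, v) \<in> parcs (add_cliques G r W)" for u v
    proof -
      have "u \<in> pverts G \<and> v \<in> pverts G \<and> u \<noteq> v"
      proof (cases "(u, v) \<in> parcs G")
        case True
        then show ?thesis by (rule arc)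
      next
        case False
        with uv obtain i where "i < r" "u \<in> W i" "v \<in> W i" "u \<noteq> v"
          by (auto simp: add_cliques_def)
        moreover from W \<open>i < r\<close> have "W i \<subseteq> pverts G" by blast
        ultimately show ?thesis by blast
      qed
      then show ?thesis using neq by blast
    qed
    moreover have "c v < card (pverts G)" if "v \<in> pverts (add_cliques G r W)" for v
      using that lt by (simp add: add_cliques_def)
    ultimately have "proper_coloring (add_cliques G r W) (card (pverts G)) c"
      unfolding proper_coloring_def by blast
    then show "\<exists>c. proper_coloring (add_cliques G r W) (card (pverts G)) c" by blast
  qed
qed

lemma strongly_colorable_strong_chromatic_number:
  "pair_graph G \<Longrightarrow> strongly_colorable G (strong_chromatic_number G)"
  unfolding strong_chromatic_number_def by (rule LeastI) (rule strongly_colorable_card)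

end

theory Submission
  imports Defs
begin

text \<open>
  The witness is the complete bipartite graph on two sides of size \<open>d\<close>. For \<open>k < 2d\<close> choose
  \<open>min k d\<close> vertices on each side and turn both choices into cliques: together they form a clique
  on \<open>2 min k d\<close> vertices, which exceeds \<open>k\<close> as soon as \<open>k > 0\<close>.
\<close>

definition complete_bipartite :: "nat \<Rightarrow> nat pair_pre_digraph" where
  "complete_bipartite d =
     \<lparr> pverts = {..<2 * d},
       parcs = {..<d} \<times> {d..<2 * d} \<union> {d..<2 * d} \<times> {..<d} \<rparr>"

lemma pair_graph_complete_bipartite: "pair_graph (complete_bipartite d)"
  by unfold_locales
    (auto simp: complete_bipartite_def symmetric_def arcs_ends_def arc_to_ends_def intro!: symI)

lemma out_degree_complete_bipartite:
  assumes "v \<in> pverts (complete_bipartite d)"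
  shows "out_degree (with_proj (complete_bipartite d)) v = d"
proof -
  have "out_arcs (with_proj (complete_bipartite d)) v =
      Pair v ` (if v < d then {d..<2 * d} else {..<d})"
    using assms by (auto simp: out_arcs_def complete_bipartite_def)
  then show ?thesis
    by (simp add: out_degree_def card_image inj_on_def)
qed

lemma not_strongly_colorable_complete_bipartite:
  assumes "k < 2 * d"
  shows "\<not> strongly_colorable (complete_bipartite d) k"
proof
  assume sc: "strongly_colorable (complete_bipartite d) k"
  define m where "m = min k d"
  \<comment> \<open>\<open>W 0\<close> starts at the first vertex of the left side,
    \<open>W 1\<close> at the first of the right. The bound \<open>m \<le> d\<close> keeps each
    within its side, and \<open>m \<le> k\<close> keeps its size admissible.\<close>
  define W where "W i = {i * d..<i * d + m}" for i :: nat
  have "disjoint_family_on W {..<2}"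
    by (auto simp: disjoint_family_on_def W_def m_def less_2_cases_iff)
  moreover have "\<forall>i<2. W i \<subseteq> pverts (complete_bipartite d) \<and> finite (W i) \<and> card (W i) \<le> k"
    by (auto simp: W_def m_def complete_bipartite_def less_2_cases_iff)
  ultimately obtain c where c: "proper_coloring (add_cliques (complete_bipartite d) 2 W) k c"
    using sc unfolding strongly_colorable_def colorable_def by blast
  have lt: "c v < k" if "v < 2 * d" for v
    using c that by (simp add: proper_coloring_def add_cliques_def complete_bipartite_def)
  have "inj_on c (W 0 \<union> W 1)"
  proof (rule inj_onI, rule ccontr)
    fix u v
    assume "u \<in> W 0 \<union> W 1" "v \<in> W 0 \<union> W 1" "c u = c v" "u \<noteq> v"
    \<comment> \<open>Vertices in the same \<open>W i\<close> are joined by an added edge, vertices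
      in different ones by an edge of the bipartite graph.\<close>
    then have "(u, v) \<in> parcs (add_cliques (complete_bipartite d) 2 W)"
      by (auto simp: add_cliques_def complete_bipartite_def W_def m_def numeral_2_eq_2 lessThan_Suc)
    with c \<open>c u = c v\<close> show False
      by (auto simp: proper_coloring_def)
  qed
  moreover have "c ` (W 0 \<union> W 1) \<subseteq> {..<k}"
    using lt by (auto simp: W_def m_def)
  ultimately have "card (W 0 \<union> W 1) \<le> k"
    using card_inj_on_le[of c "W 0 \<union> W 1" "{..<k}"] by simp
  moreover have "card (W 0 \<union> W 1) = 2 * m"
    by (subst card_Un_disjoint) (auto simp: W_def m_def)
  \<comment> \<open>For \<open>k = 0\<close> both cliques are empty and counting gives nothing; but
    vertex \<open>0\<close> exists since \<open>0 < 2 * d\<close>, and its color lies below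
    \<open>k\<close>.\<close>
  moreover have "0 < k"
    using lt[of 0] assms by simp
  \<comment> \<open>If \<open>k \<le> d\<close>, the count reads \<open>2 * k \<le> k\<close>;
    otherwise it reads \<open>2 * d \<le> k\<close>.\<close>
  ultimately show False
    using assms by (simp add: m_def)
qed

theorem theorem10:
  fixes d :: nat
  assumes "d \<ge> 1"
  shows "max_strong_chromatic_number d \<ge> enat (2 * d)"
proof -
  let ?G = "complete_bipartite d"
  \<comment> \<open>The least \<open>k\<close> is attained, so it cannot be one of the excluded
    values below \<open>2 * d\<close>.\<close>
  have "2 * d \<le> strong_chromatic_number ?G"
    using strongly_colorable_strong_chromatic_number[OF pair_graph_complete_bipartite]
      not_strongly_colorable_complete_bipartite
    by (meson not_le)
  moreover have "enat (strong_chromatic_number ?G) \<le> max_strong_chromatic_number d"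
    unfolding max_strong_chromatic_number_def
    by (rule SUP_upper) (simp add: pair_graph_complete_bipartite out_degree_complete_bipartite)
  ultimately show ?thesis
    using order_trans enat_ord_simps(1) by blast
qed

end
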